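(* A digraph is $1$-extremal if and only if it is a directed cycle.
   Context: Digraphs have no loops and no parallel arcs but may contain digons; a directed cycle may have length 2 (a digon). $\vec{\chi}(D)$ is the dichromatic number (least number of parts in a partition of $V(D)$ into sets inducing acyclic subdigraphs). $\lambda(D)$ is the maximum, over ordered pairs of distinct vertices $(u,v)$, of the maximum number of pairwise arc-disjoint directed $uv$-paths. A digraph $D$ is $k$-extremal if it is strongly connected, its underlying graph is 2-connected, and $\vec{\chi}(D)=k+1=\lambda(D)+1$. *)

theory Defs
  imports Complex_Main "HOL-Library.Disjoint_Sets" "Graph_Theory.Graph_Theory"
begin

definition acyclic_digraph :: "('a, 'b) pre_digraph \<Rightarrow> bool" where
  "acyclic_digraph D \<longleftrightarrow> \<not> (\<exists>p. pre_digraph.cycle D p)"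

definition dichromatic_number :: "('a, 'b) pre_digraph \<Rightarrow> nat" where
  "dichromatic_number D =
     (LEAST n. \<exists>P. partition_on (verts D) P \<and> finite P \<and> card P = n \<and>
        (\<forall>S\<in>P. acyclic_digraph (D \<restriction> S)))"

text \<open>
  A path is the list of its arcs. For \<open>u \<noteq> v\<close> such a list is nonempty, so distinct members of an
  arc-disjoint family are distinct as paths and \<open>card P\<close> counts them correctly.
\<close>

definition arc_disjoint_paths ::
    "('a, 'b) pre_digraph \<Rightarrow> 'a \<Rightarrow> 'a \<Rightarrow> 'b awalk set \<Rightarrow> bool" where
  "arc_disjoint_paths D u v P \<longleftrightarrow>
     finite P \<and> (\<forall>p\<in>P. pre_digraph.apath D u p v) \<and> pairwise (\<lambda>p q. disjnt (set p) (set q)) P"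

definition local_arc_connectivity :: "('a, 'b) pre_digraph \<Rightarrow> 'a \<Rightarrow> 'a \<Rightarrow> nat" where
  "local_arc_connectivity D u v = Max {card P | P. arc_disjoint_paths D u v P}"

text \<open>
  For finite digraphs the supremum is a maximum; it is \<open>0\<close> if there is no pair of distinct vertices.
\<close>

definition max_local_arc_connectivity :: "('a, 'b) pre_digraph \<Rightarrow> nat" where
  "max_local_arc_connectivity D =
     Sup {local_arc_connectivity D u v | u v. u \<in> verts D \<and> v \<in> verts D \<and> u \<noteq> v}"

text \<open>
  Undirected graphs are represented as symmetric digraphs, and the underlying graph of \<open>D\<close> is
  \<open>mk_symmetric D\<close>. The complete graph on two vertices counts as 2-connected (it is connected and
  has no cut vertex), so that the digon, which is a directed cycle, has a 2-connected underlying
  graph.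
\<close>

definition two_connected :: "('a, 'b) pre_digraph \<Rightarrow> bool" where
  "two_connected G \<longleftrightarrow>
     2 \<le> card (verts G) \<and> Digraph_Component.connected G \<and>
     (\<forall>v\<in>verts G. Digraph_Component.connected (pre_digraph.del_vert G v))"

definition extremal :: "nat \<Rightarrow> ('a, 'b) pre_digraph \<Rightarrow> bool" where
  "extremal k D \<longleftrightarrow>
     strongly_connected D \<and> two_connected (with_proj (mk_symmetric D)) \<and>
     dichromatic_number D = k + 1 \<and> k + 1 = max_local_arc_connectivity D + 1"

text \<open>
  In a loopless digraph the cycle \<open>p\<close> has length at least 2, and length 2 is the digon. The tails
  of the arcs of a cycle are exactly its vertices.
\<close>

definition directed_cycle :: "('a, 'b) pre_digraph \<Rightarrow> bool" where
  "directed_cycle D \<longleftrightarrow>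
     (\<exists>p. pre_digraph.cycle D p \<and> arcs D = set p \<and> verts D = tail D ` set p)"

end

theory Submission
  imports Defs
begin

text \<open>
  Suppose that \<open>D\<close> is 1-extremal and let \<open>C\<close> be a directed cycle in \<open>D\<close>; there is one because \<open>D\<close>
  is not 1-colourable. Delete the arcs of \<open>C\<close>. In the remaining digraph \<open>R\<close> no vertex of \<open>C\<close> reaches
  another one, since such a path and a segment of \<open>C\<close> would be two arc-disjoint paths with the same
  ends. By strong connectivity every vertex \<open>z\<close> is reached in \<open>R\<close> from some vertex of \<open>C\<close> and reaches
  some vertex of \<open>C\<close> in \<open>R\<close>, so both are the same vertex \<open>c z\<close>, and \<open>c\<close> is constant along the arcs
  of \<open>R\<close>. If \<open>z\<close> is not on \<open>C\<close>, then \<open>c z\<close> separates the rest of its fibre from the rest of \<open>C\<close>,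
  contrary to 2-connectivity. Thus \<open>C\<close> contains all vertices, and an arc of \<open>R\<close> would be a loop.

  Conversely, all the properties of a directed cycle follow from strong connectivity and the fact
  that every vertex has only one incoming arc.
\<close>

section \<open>Connectivity and 2-connectivity in terms of cuts\<close>

text \<open>The vertices reachable from \<open>u\<close> in the symmetrization form a set that no
  arc enters or leaves, so the cut condition forces it to be everything. Conversely, such a set
  keeps every walk that starts in it. Nonemptiness appears because \<open>strongly_connected\<close>
  demands it.\<close>

lemma connected_iff_cut:
  fixes G :: "('a, 'b) pre_digraph"
  assumes "wf_digraph G"
  shows "Digraph_Component.connected G \<longleftrightarrow> verts G \<noteq> {} \<and>
    (\<forall>S \<subseteq> verts G. S \<noteq> {} \<longrightarrow> (\<forall>e \<in> arcs G. tail G e \<in> S \<longleftrightarrow> head G e \<in> S) \<longrightarrow> S = verts G)"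
    (is "_ \<longleftrightarrow> _ \<and> ?cut")
proof -
  interpret G: wf_digraph G by fact
  interpret U: pair_wf_digraph "mk_symmetric G" by (rule G.wellformed_mk_symmetric)
  have "Digraph_Component.connected G" if ne: "verts G \<noteq> {}" and cut: ?cut
    unfolding Digraph_Component.connected_def
  proof (rule strongly_connectedI)
    fix u v assume uv: "u \<in> verts (with_proj (mk_symmetric G))" "v \<in> verts (with_proj (mk_symmetric G))"
    let ?S = "{y. u \<rightarrow>\<^sup>*\<^bsub>mk_symmetric G\<^esub> y}"
    have "?S \<subseteq> verts G" by (auto elim: reachable_in_vertsE)
    moreover have "u \<in> ?S" using uv by auto
    moreover have "tail G e \<in> ?S \<longleftrightarrow> head G e \<in> ?S" if "e \<in> arcs G" for e
    proof -
      have "tail G e \<rightarrow>\<^bsub>mk_symmetric G\<^esub> head G e" "head G e \<rightarrow>\<^bsub>mk_symmetric G\<^esub> tail G e"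
        using that by (auto simp: parcs_mk_symmetric)
      then show ?thesis by (auto intro: U.reachable_adj_trans)
    qed
    ultimately have "?S = verts G" using cut by blast
    then show "u \<rightarrow>\<^sup>*\<^bsub>mk_symmetric G\<^esub> v" using uv by auto
  qed (use ne in simp)
  moreover have "S = verts G"
    if con: "Digraph_Component.connected G" and S: "S \<subseteq> verts G" "S \<noteq> {}"
      and cut: "\<forall>e \<in> arcs G. tail G e \<in> S \<longleftrightarrow> head G e \<in> S" for S
  proof -
    obtain s where s: "s \<in> S" using S by auto
    have "v \<in> S" if "v \<in> verts G" for v
    proof -
      have "s \<rightarrow>\<^sup>*\<^bsub>mk_symmetric G\<^esub> v"
        using con that s S by (auto simp: Digraph_Component.connected_def strongly_connected_def)
      then show ?thesis
        by (induct rule: U.reachable_induct) (use s cut in \<open>auto simp: parcs_mk_symmetric\<close>)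
    qed
    then show ?thesis using S by auto
  qed
  moreover have "verts G \<noteq> {}" if "Digraph_Component.connected G"
    using that by (auto simp: Digraph_Component.connected_def strongly_connected_def)
  ultimately show ?thesis by metis
qed

text \<open>The cut condition is symmetric in tail and head, so it can be tested on the arcs of
  \<open>D\<close> instead of those of the symmetrization; deleting \<open>v\<close> only discards
  the arcs at \<open>v\<close>.\<close>

lemma two_connected_mk_symmetric_iff_cut:
  fixes D :: "('a, 'b) pre_digraph"
  assumes "wf_digraph D"
  shows "two_connected (with_proj (mk_symmetric D)) \<longleftrightarrow>
    2 \<le> card (verts D) \<and> Digraph_Component.connected D \<and>
    (\<forall>v \<in> verts D. verts D - {v} \<noteq> {} \<and>
      (\<forall>S \<subseteq> verts D - {v}. S \<noteq> {} \<longrightarrow>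
        (\<forall>e \<in> arcs D. tail D e \<noteq> v \<longrightarrow> head D e \<noteq> v \<longrightarrow> (tail D e \<in> S \<longleftrightarrow> head D e \<in> S)) \<longrightarrow>
        S = verts D - {v}))"
proof -
  interpret D: wf_digraph D by fact
  interpret U: pair_wf_digraph "mk_symmetric D" by (rule D.wellformed_mk_symmetric)
  have arcsU: "(\<forall>e \<in> parcs (mk_symmetric D). Q e) \<longleftrightarrow>
      (\<forall>e \<in> arcs D. Q (tail D e, head D e) \<and> Q (head D e, tail D e))" for Q
    by (auto simp: parcs_mk_symmetric)
  have "Digraph_Component.connected (with_proj (mk_symmetric D)) \<longleftrightarrow> Digraph_Component.connected D"
    unfolding connected_iff_cut[OF D.wf_digraph] connected_iff_cut[OF U.wf_digraph]
    by (simp add: arcsU) blast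
  moreover have "Digraph_Component.connected (pre_digraph.del_vert (with_proj (mk_symmetric D)) v) \<longleftrightarrow>
      verts D - {v} \<noteq> {} \<and>
      (\<forall>S \<subseteq> verts D - {v}. S \<noteq> {} \<longrightarrow>
        (\<forall>e \<in> arcs D. tail D e \<noteq> v \<longrightarrow> head D e \<noteq> v \<longrightarrow> (tail D e \<in> S \<longleftrightarrow> head D e \<in> S)) \<longrightarrow>
        S = verts D - {v})" for v
  proof -
    have "(\<forall>e \<in> arcs (U.del_vert v). tail (U.del_vert v) e \<in> S \<longleftrightarrow> head (U.del_vert v) e \<in> S) \<longleftrightarrow>
        (\<forall>e \<in> arcs D. tail D e \<noteq> v \<longrightarrow> head D e \<noteq> v \<longrightarrow> (tail D e \<in> S \<longleftrightarrow> head D e \<in> S))" for S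
      by (auto simp: pre_digraph.del_vert_simps parcs_mk_symmetric)
    then show ?thesis
      unfolding connected_iff_cut[OF U.wf_digraph_del_vert]
      by (simp add: pre_digraph.del_vert_simps)
  qed
  ultimately show ?thesis unfolding two_connected_def by simp
qed

section \<open>The dichromatic number as an attained minimum\<close>

lemma induce_subgraph_verts:
  assumes "wf_digraph D"
  shows "D \<restriction> verts D = D"
proof -
  interpret wf_digraph D by fact
  have "{e \<in> arcs D. tail D e \<in> verts D \<and> head D e \<in> verts D} = arcs D" by auto
  then show ?thesis by (simp add: induce_subgraph_def)
qed

text \<open>The \<open>LEAST\<close> is attained once some admissible partition exists. The
  partition into singletons is one: without loops a singleton induces no arcs, and a cycle is a
  nonempty list of arcs.\<close>

lemma dichromatic_number_witness:
  fixes D :: "('a, 'b) pre_digraph"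
  assumes "digraph D"
  shows "\<exists>P. partition_on (verts D) P \<and> finite P \<and> card P = dichromatic_number D \<and>
    (\<forall>S\<in>P. acyclic_digraph (D \<restriction> S))"
proof -
  interpret D: digraph D by fact
  let ?P = "(\<lambda>v. {v}) ` verts D"
  have "partition_on (verts D) ?P" by (auto simp: partition_on_def disjoint_def)
  moreover have "acyclic_digraph (D \<restriction> {v})" for v
  proof -
    have "arcs (D \<restriction> {v}) = {}" using D.no_loops by (fastforce simp: induce_subgraph_def)
    then show ?thesis
      unfolding acyclic_digraph_def pre_digraph.cycle_def pre_digraph.awalk_def
      by (metis set_empty subset_empty)
  qed
  ultimately have "\<exists>n P. partition_on (verts D) P \<and> finite P \<and> card P = n \<and>
      (\<forall>S\<in>P. acyclic_digraph (D \<restriction> S))"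
    by (intro exI[of _ "card ?P"] exI[of _ ?P]) auto
  then show ?thesis unfolding dichromatic_number_def by (rule LeastI_ex)
qed

lemma dichromatic_number_le:
  assumes "partition_on (verts D) P" "finite P" "\<forall>S\<in>P. acyclic_digraph (D \<restriction> S)"
  shows "dichromatic_number D \<le> card P"
  unfolding dichromatic_number_def using assms by (intro Least_le) blast

text \<open>A partition of a nonempty set has at least one part; if it has at most one, that part is
  \<open>verts D\<close>, which induces \<open>D\<close> itself.\<close>

lemma dichromatic_number_le_1_iff:
  fixes D :: "('a, 'b) pre_digraph"
  assumes "digraph D" "verts D \<noteq> {}"
  shows "dichromatic_number D \<le> 1 \<longleftrightarrow> acyclic_digraph D"
proof
  interpret D: digraph D by fact
  assume "dichromatic_number D \<le> 1"
  then obtain P where P: "partition_on (verts D) P" "finite P" "card P \<le> 1"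
      "\<forall>S\<in>P. acyclic_digraph (D \<restriction> S)"
    using dichromatic_number_witness[OF assms(1)] by metis
  have "P \<noteq> {}" using P(1) assms(2) by (auto simp: partition_on_def)
  then have "card P = 1" using P by (metis card_0_eq le_antisym less_one not_le)
  then obtain S where "P = {S}" by (auto simp: card_1_singleton_iff)
  then have "S = verts D" using P(1) by (auto simp: partition_on_def)
  then show "acyclic_digraph D"
    using P(4) \<open>P = {S}\<close> by (simp add: induce_subgraph_verts[OF D.wf_digraph])
next
  interpret D: digraph D by fact
  assume "acyclic_digraph D"
  then show "dichromatic_number D \<le> 1"
    using dichromatic_number_le[of D "{verts D}"] assms(2)
    by (simp add: induce_subgraph_verts[OF D.wf_digraph] partition_on_def)
qed

section \<open>Bounds for arc-connectivity\<close>

text \<open>Supplies the finiteness that reasoning about \<open>Max\<close> in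
  \<open>local_arc_connectivity\<close> requires.\<close>

lemma finite_arc_disjoint_paths:
  fixes D :: "('a, 'b) pre_digraph"
  assumes "digraph D"
  shows "finite {P. arc_disjoint_paths D u v P}"
proof -
  interpret D: digraph D by fact
  have "{P. arc_disjoint_paths D u v P} \<subseteq> Pow {p. D.apath u p v}"
    by (auto simp: arc_disjoint_paths_def)
  then show ?thesis using D.apaths_finite by (metis finite_Pow_iff finite_subset)
qed

lemma local_arc_connectivity_ge:
  assumes "digraph D" "arc_disjoint_paths D u v P"
  shows "card P \<le> local_arc_connectivity D u v"
  unfolding local_arc_connectivity_def
  using assms finite_arc_disjoint_paths[OF assms(1), of u v]
  by (intro Max_ge) (auto simp: setcompr_eq_image)

lemma local_arc_connectivity_le:
  assumes "digraph D" "\<And>P. arc_disjoint_paths D u v P \<Longrightarrow> card P \<le> n"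
  shows "local_arc_connectivity D u v \<le> n"
proof -
  \<comment> \<open>The empty family makes the set under \<open>Max\<close> nonempty.\<close>
  have "arc_disjoint_paths D u v {}" by (simp add: arc_disjoint_paths_def)
  then show ?thesis
    unfolding local_arc_connectivity_def
    using assms(2) finite_arc_disjoint_paths[OF assms(1), of u v]
    by (subst Max_le_iff) (auto simp: setcompr_eq_image)
qed

lemma max_local_arc_connectivity_ge:
  fixes D :: "('a, 'b) pre_digraph"
  assumes "digraph D" "u \<in> verts D" "v \<in> verts D" "u \<noteq> v"
  shows "local_arc_connectivity D u v \<le> max_local_arc_connectivity D"
proof -
  interpret D: digraph D by fact
  let ?A = "{local_arc_connectivity D u v | u v. u \<in> verts D \<and> v \<in> verts D \<and> u \<noteq> v}"
  \<comment> \<open>\<open>cSup_upper\<close> needs a bounded set; there are only finitely many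
    pairs of vertices.\<close>
  have "?A \<subseteq> (\<lambda>(u, v). local_arc_connectivity D u v) ` (verts D \<times> verts D)" by auto
  then have "finite ?A" by (rule finite_subset) simp
  then show ?thesis
    unfolding max_local_arc_connectivity_def
    using assms by (intro cSup_upper bdd_above_finite) auto
qed

text \<open>The given pair of distinct vertices makes the set under \<open>Sup\<close> nonempty, as
  \<open>cSup_least\<close> requires.\<close>

lemma max_local_arc_connectivity_le:
  assumes "u \<in> verts D" "v \<in> verts D" "u \<noteq> v"
    and "\<And>u v. u \<in> verts D \<Longrightarrow> v \<in> verts D \<Longrightarrow> u \<noteq> v \<Longrightarrow> local_arc_connectivity D u v \<le> n"
  shows "max_local_arc_connectivity D \<le> n"
  unfolding max_local_arc_connectivity_def
  using assms by (intro cSup_least) auto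

section \<open>Cycles, and paths with prescribed arcs\<close>

text \<open>Every vertex of the closed walk reaches its base point and is reached from it.\<close>

lemma cycle_reachable:
  fixes D :: "('a, 'b) pre_digraph"
  assumes "wf_digraph D" "pre_digraph.cycle D p" "a \<in> tail D ` set p" "b \<in> tail D ` set p"
  shows "a \<rightarrow>\<^sup>*\<^bsub>D\<^esub> b"
proof -
  interpret D: wf_digraph D by fact
  obtain u where u: "D.awalk u p u" using assms(2) by (auto simp: D.cycle_def)
  have "tail D ` set p \<subseteq> set (D.awalk_verts u p)" by (auto simp: D.awalk_verts_conv)
  then have "u \<rightarrow>\<^sup>*\<^bsub>D\<^esub> b" "a \<rightarrow>\<^sup>*\<^bsub>D\<^esub> u"
    using assms D.awalk_verts_reachable_from[OF u] D.awalk_verts_reachable_to[OF u] by auto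
  then show ?thesis using D.reachable_trans by blast
qed

text \<open>The vertex list of the walk is both the tails followed by the last head and the first
  tail followed by the heads. As the walk is closed, the two extra entries are one vertex, which
  occurs among the tails and among the heads.\<close>

lemma cycle_image_head_eq_tail:
  fixes D :: "('a, 'b) pre_digraph"
  assumes "wf_digraph D" "pre_digraph.cycle D p"
  shows "head D ` set p = tail D ` set p"
proof -
  interpret D: wf_digraph D by fact
  obtain u where u: "D.awalk u p u" "p \<noteq> []" using assms by (auto simp: D.cycle_def)
  have c: "D.cas u p u" using u by (simp add: D.awalk_def)
  have "tail D (hd p) = u" using c u(2) by (cases p) auto
  moreover have "head D (last p) = u"
    using D.awlast_if_cas[OF c] u(2) by (simp add: D.awalk_verts_conv)
  moreover have "map (tail D) p @ [head D (last p)] = tail D (hd p) # map (head D) p"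
    using D.awalk_verts_conv[of u p] D.awalk_verts_conv'[OF c] u(2) by simp
  then have "set (map (tail D) p @ [head D (last p)]) = set (tail D (hd p) # map (head D) p)"
    by (rule arg_cong)
  moreover have "tail D (hd p) \<in> tail D ` set p" "head D (last p) \<in> head D ` set p"
    using u(2) by auto
  ultimately show ?thesis by (simp add: insert_absorb)
qed

text \<open>The vertices after the first, which \<open>cycle\<close> requires to be distinct, are
  exactly the heads of the arcs in order.\<close>

lemma cycle_inj_on_head:
  fixes D :: "('a, 'b) pre_digraph"
  assumes "pre_digraph.cycle D p"
  shows "inj_on (head D) (set p)"
proof -
  interpret pre_digraph D .
  obtain u where u: "awalk u p u" "p \<noteq> []" "distinct (tl (awalk_verts u p))"
    using assms by (auto simp: cycle_def)
  then have "distinct (map (head D) p)"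
    using awalk_verts_conv'[of u p u] by (simp add: awalk_def)
  then show ?thesis by (simp add: distinct_map)
qed

text \<open>Restricting the arc set keeps the end maps, so paths of the subdigraph are paths of
  \<open>D\<close>. This turns reachability into a path confined to \<open>A\<close>, from which
  arc-disjointness can be read off.\<close>

lemma reachable_restrict_arcs_imp_apath:
  fixes D :: "('a, 'b) pre_digraph"
  assumes "wf_digraph D" "A \<subseteq> arcs D" "a \<rightarrow>\<^sup>*\<^bsub>D\<lparr>arcs := A\<rparr>\<^esub> b"
  shows "\<exists>q. pre_digraph.apath D a q b \<and> set q \<subseteq> A"
proof -
  let ?H = "D\<lparr>arcs := A\<rparr>"
  interpret D: wf_digraph D by fact
  interpret H: wf_digraph ?H using assms(2) by unfold_locales auto
  have comp: "compatible ?H D" by (simp add: compatible_def)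
  obtain q where "H.apath a q b" using assms(3) H.reachable_apath by blast
  then have "D.apath a q b \<and> set q \<subseteq> A"
    using assms(2) compatible_cas[OF comp] compatible_awalk_verts[OF comp]
    by (auto simp: H.apath_def D.apath_def H.awalk_def D.awalk_def)
  then show ?thesis by blast
qed

lemma disjoint_reachable_imp_max_local_arc_connectivity_ge_2:
  fixes D :: "('a, 'b) pre_digraph"
  assumes "digraph D" "A \<subseteq> arcs D" "B \<subseteq> arcs D" "A \<inter> B = {}" "a \<noteq> b"
    and "a \<rightarrow>\<^sup>*\<^bsub>D\<lparr>arcs := A\<rparr>\<^esub> b" "a \<rightarrow>\<^sup>*\<^bsub>D\<lparr>arcs := B\<rparr>\<^esub> b"
  shows "2 \<le> max_local_arc_connectivity D"
proof -
  interpret D: digraph D by fact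
  obtain q r where q: "D.apath a q b" "set q \<subseteq> A" and r: "D.apath a r b" "set r \<subseteq> B"
    using reachable_restrict_arcs_imp_apath[OF D.wf_digraph] assms by metis
  \<comment> \<open>Disjoint arc sets alone do not separate \<open>q\<close> from \<open>r\<close>:
    both could be empty lists, but \<open>a\<close> and \<open>b\<close> differ.\<close>
  have "q \<noteq> []" using q assms(5) by (auto simp: D.apath_Nil_iff)
  moreover have disj: "set q \<inter> set r = {}" using q r assms(4) by blast
  ultimately have "q \<noteq> r" by auto
  then have "card {q, r} = 2" by simp
  moreover have "arc_disjoint_paths D a b {q, r}"
    using q r disj by (auto simp: arc_disjoint_paths_def pairwise_def disjnt_def)
  ultimately have "2 \<le> local_arc_connectivity D a b"
    using local_arc_connectivity_ge[OF assms(1)] by metis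
  moreover have "a \<in> verts D" "b \<in> verts D"
    using q(1) by (auto simp: D.apath_def D.awalk_last_in_verts D.awalk_hd_in_verts)
  ultimately show ?thesis
    using max_local_arc_connectivity_ge[OF assms(1) _ _ assms(5)] by force
qed

section \<open>From 1-extremal digraphs to directed cycles\<close>

lemma extremal_1_imp_directed_cycle:
  fixes D :: "('a, 'b) pre_digraph"
  assumes "digraph D" "extremal 1 D"
  shows "directed_cycle D"
proof -
  interpret D: digraph D by fact
  from assms(2) have strong: "strongly_connected D"
    and two: "two_connected (with_proj (mk_symmetric D))"
    and chi: "dichromatic_number D = 2"
    and lam: "max_local_arc_connectivity D = 1"
    by (auto simp: extremal_def)
  have "verts D \<noteq> {}" using strong by (simp add: strongly_connected_def)
  then have "\<not> acyclic_digraph D"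
    using chi dichromatic_number_le_1_iff[OF assms(1)] by simp
  then obtain p where p: "D.cycle p" by (auto simp: acyclic_digraph_def)
  define C where "C = tail D ` set p"
  have pD: "set p \<subseteq> arcs D" "p \<noteq> []" using p by (auto simp: D.cycle_def D.awalk_def)
  have CD: "C \<subseteq> verts D" using pD by (auto simp: C_def)
  have headC: "head D ` set p = C"
    using cycle_image_head_eq_tail[OF D.wf_digraph p] by (simp add: C_def)
  define R where "R = D\<lparr>arcs := arcs D - set p\<rparr>"
  interpret R: wf_digraph R by unfold_locales (auto simp: R_def)
  have vR: "verts R = verts D" by (simp add: R_def)
  have sep: "a = b" if ab: "a \<in> C" "b \<in> C" "a \<rightarrow>\<^sup>*\<^bsub>R\<^esub> b" for a b
  proof (rule ccontr)
    \<comment> \<open>In \<open>?H\<close> the list \<open>p\<close> is still a cycle, so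
      \<open>cycle_reachable\<close> gives a connection that uses arcs of \<open>p\<close>
      only.\<close>
    let ?H = "D\<lparr>arcs := set p\<rparr>"
    assume "a \<noteq> b"
    have comp: "compatible ?H D" by (simp add: compatible_def)
    have "wf_digraph ?H" using pD by unfold_locales auto
    moreover have "pre_digraph.cycle ?H p"
      using p compatible_cas[OF comp] compatible_awalk_verts[OF comp]
      by (auto simp: pre_digraph.cycle_def pre_digraph.awalk_def)
    ultimately have "a \<rightarrow>\<^sup>*\<^bsub>?H\<^esub> b"
      using cycle_reachable[of ?H p a b] ab by (simp add: C_def)
    then have "2 \<le> max_local_arc_connectivity D"
      using disjoint_reachable_imp_max_local_arc_connectivity_ge_2
        [OF assms(1) pD(1), of "arcs D - set p" a b] ab \<open>a \<noteq> b\<close> by (auto simp: R_def)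
    then show False using lam by simp
  qed
  have arcR: "tail D e \<rightarrow>\<^bsub>R\<^esub> head D e" if "e \<in> arcs D" "e \<notin> set p" for e
    using that by (auto simp: R_def arcs_ends_conv)
  obtain c0 where c0: "c0 \<in> C" using pD(2) by (fastforce simp: C_def neq_Nil_conv)
  \<comment> \<open>Follow a walk in \<open>D\<close> from \<open>c0\<close>: an arc of
    \<open>p\<close> ends on \<open>C\<close>, so its head can serve as the new start; any other arc
    extends the walk in \<open>R\<close>. \<open>exit\<close> is the mirror image.\<close>
  have entry: "\<exists>a\<in>C. a \<rightarrow>\<^sup>*\<^bsub>R\<^esub> z" if "z \<in> verts D" for z
  proof -
    have "c0 \<rightarrow>\<^sup>*\<^bsub>D\<^esub> z" using strong c0 CD that by (auto simp: strongly_connected_def)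
    then show ?thesis
    proof (induct rule: D.reachable_induct)
      case base
      then show ?case using c0 vR by auto
    next
      case (step x y)
      obtain e where e: "e \<in> arcs D" "tail D e = x" "head D e = y" using step(2) by auto
      show ?case
      proof (cases "e \<in> set p")
        case True
        then have "y \<in> C" using headC e by auto
        then show ?thesis using CD vR by auto
      next
        case False
        then show ?thesis using step(3) arcR[OF e(1)] e R.reachable_adj_trans by metis
      qed
    qed
  qed
  have exit: "\<exists>b\<in>C. z \<rightarrow>\<^sup>*\<^bsub>R\<^esub> b" if "z \<in> verts D" for z
  proof -
    have "z \<rightarrow>\<^sup>*\<^bsub>D\<^esub> c0" using strong c0 CD that by (auto simp: strongly_connected_def)
    then show ?thesis
    proof (induct rule: D.converse_reachable_induct)
      case base
      then show ?case using c0 vR by auto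
    next
      case (step x y)
      obtain e where e: "e \<in> arcs D" "tail D e = x" "head D e = y" using step(1) by auto
      show ?case
      proof (cases "e \<in> set p")
        case True
        then have "x \<in> C" using e by (auto simp: C_def)
        then show ?thesis using CD vR by auto
      next
        case False
        then show ?thesis using step(3) arcR[OF e(1)] e R.adj_reachable_trans by metis
      qed
    qed
  qed
  \<comment> \<open>The entry vertex reaches the exit vertex through \<open>z\<close> in
    \<open>R\<close>, so \<open>sep\<close> identifies them.\<close>
  have "\<exists>c\<in>C. c \<rightarrow>\<^sup>*\<^bsub>R\<^esub> z \<and> z \<rightarrow>\<^sup>*\<^bsub>R\<^esub> c" if "z \<in> verts D" for z
    using entry[OF that] exit[OF that] sep R.reachable_trans by metis
  then obtain c where c: "c z \<in> C" "c z \<rightarrow>\<^sup>*\<^bsub>R\<^esub> z" "z \<rightarrow>\<^sup>*\<^bsub>R\<^esub> c z" if "z \<in> verts D" for z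
    by metis
  have c_arc: "c (tail D e) = c (head D e)" if e: "e \<in> arcs D" "e \<notin> set p" for e
  proof (rule sep)
    show "c (tail D e) \<in> C" "c (head D e) \<in> C" using e c by auto
    show "c (tail D e) \<rightarrow>\<^sup>*\<^bsub>R\<^esub> c (head D e)"
      using c(2)[of "tail D e"] c(3)[of "head D e"] arcR[OF e] e
      by (meson D.wellformed R.adj_reachable_trans R.reachable_trans)
  qed
  have c_id: "c z = z" if "z \<in> C" for z
    using that CD c[of z] sep by blast
  have two_cut: "S = verts D - {x}"
    if "x \<in> verts D" "S \<subseteq> verts D - {x}" "S \<noteq> {}"
      "\<And>e. e \<in> arcs D \<Longrightarrow> tail D e \<noteq> x \<Longrightarrow> head D e \<noteq> x \<Longrightarrow> tail D e \<in> S \<longleftrightarrow> head D e \<in> S"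
    for x S
    using two that unfolding two_connected_mk_symmetric_iff_cut[OF D.wf_digraph] by blast
  have "C = verts D"
  proof (rule ccontr)
    assume "C \<noteq> verts D"
    then obtain z where z: "z \<in> verts D" "z \<notin> C" using CD by auto
    \<comment> \<open>No arc avoiding \<open>c z\<close> crosses the boundary of \<open>S\<close>:
      an arc of \<open>p\<close> has both ends on \<open>C\<close>, which \<open>S\<close> does not
      meet because \<open>c\<close> fixes \<open>C\<close>, and any other arc stays in one fibre of
      \<open>c\<close>.\<close>
    define S where "S = {y \<in> verts D. c y = c z} - {c z}"
    have "S = verts D - {c z}"
    proof (rule two_cut)
      have "z \<in> S" using z c(1)[OF z(1)] by (auto simp: S_def)
      then show "S \<noteq> {}" by blast
      fix e assume e: "e \<in> arcs D" "tail D e \<noteq> c z" "head D e \<noteq> c z"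
      show "tail D e \<in> S \<longleftrightarrow> head D e \<in> S"
      proof (cases "e \<in> set p")
        case True
        then have "tail D e \<in> C" "head D e \<in> C" using headC by (auto simp: C_def)
        then show ?thesis using c_id e by (auto simp: S_def)
      next
        case False
        then show ?thesis using c_arc e by (auto simp: S_def)
      qed
    qed (use z c CD in \<open>auto simp: S_def\<close>)
    \<comment> \<open>Without loops \<open>C\<close> has a second vertex; it would lie in
      \<open>S\<close>, hence in the fibre of \<open>c z\<close>.\<close>
    moreover obtain y where y: "y \<in> C" "y \<noteq> c z"
      using pD headC D.no_loops
      by (metis C_def image_eqI list.set_intros(1) neq_Nil_conv subsetD)
    ultimately have "c y = c z" using CD by (auto simp: S_def)
    then show False using y c_id by simp
  qed
  moreover have "arcs D = set p"
  proof (rule ccontr)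
    assume "arcs D \<noteq> set p"
    then obtain e where e: "e \<in> arcs D" "e \<notin> set p" using pD by auto
    then have "tail D e = head D e" using c_arc[OF e] c_id \<open>C = verts D\<close> by auto
    then show False using D.no_loops e by auto
  qed
  ultimately show ?thesis using p by (auto simp: directed_cycle_def C_def)
qed

section \<open>From directed cycles to 1-extremal digraphs\<close>

lemma directed_cycle_imp_extremal_1:
  fixes D :: "('a, 'b) pre_digraph"
  assumes "digraph D" "directed_cycle D"
  shows "extremal 1 D"
proof -
  interpret D: digraph D by fact
  obtain p where p: "D.cycle p" "arcs D = set p" "verts D = tail D ` set p"
    using assms(2) by (auto simp: directed_cycle_def)
  have pne: "p \<noteq> []" using p by (auto simp: D.cycle_def)
  have inj: "inj_on (head D) (arcs D)" using cycle_inj_on_head p by metis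
  have heads: "verts D = head D ` arcs D"
    using cycle_image_head_eq_tail[OF D.wf_digraph p(1)] p by simp
  have reach: "a \<rightarrow>\<^sup>*\<^bsub>D\<^esub> b" if "a \<in> verts D" "b \<in> verts D" for a b
    using cycle_reachable[OF D.wf_digraph p(1)] that p(3) by simp
  obtain e0 where e0: "e0 \<in> arcs D" using pne p(2) by (cases p) auto
  have strong: "strongly_connected D" using reach D.tail_in_verts[OF e0] by blast
  have card2: "2 \<le> card (verts D)"
    using card_mono[of "verts D" "{tail D e0, head D e0}"] e0 D.no_loops[OF e0] by auto

  have "S = verts D - {v}"
    if v: "v \<in> verts D" and S: "S \<subseteq> verts D - {v}" "S \<noteq> {}"
      and cut: "\<forall>e \<in> arcs D. tail D e \<noteq> v \<longrightarrow> head D e \<noteq> v \<longrightarrow> (tail D e \<in> S \<longleftrightarrow> head D e \<in> S)"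
    for v S
  proof -
    \<comment> \<open>Every walk from \<open>x\<close> to \<open>v\<close> enters \<open>v\<close>
      by its only incoming arc \<open>f\<close>. Membership in \<open>S\<close> passes back along
      the walk from \<open>tail D f\<close>, so all vertices other than \<open>v\<close> agree on
      it.\<close>
    obtain f where f: "f \<in> arcs D" "head D f = v" using v heads by auto
    have "x \<noteq> v \<Longrightarrow> x \<in> S \<longleftrightarrow> tail D f \<in> S" if "x \<rightarrow>\<^sup>*\<^bsub>D\<^esub> v" for x
      using that
    proof (induct rule: D.converse_reachable_induct)
      case (step x y)
      obtain e where e: "e \<in> arcs D" "tail D e = x" "head D e = y" using step(1) by auto
      show ?case
      proof (cases "y = v")
        case True
        then have "e = f" using e f inj by (metis inj_onD)
        then show ?thesis using e by simp
      next
        case False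
        then show ?thesis using step e cut by auto
      qed
    qed simp
    then have "x \<in> S \<longleftrightarrow> tail D f \<in> S" if "x \<in> verts D - {v}" for x
      using that reach v by auto
    then show ?thesis using S by auto
  qed
  moreover have "verts D - {v} \<noteq> {}" for v
  proof
    assume "verts D - {v} = {}"
    then have "card (verts D) \<le> card {v}" by (intro card_mono) auto
    then show False using card2 by simp
  qed
  moreover have "Digraph_Component.connected D"
    using strong D.reachable_mk_symmetricI
    by (auto simp: Digraph_Component.connected_def strongly_connected_def)
  ultimately have two: "two_connected (with_proj (mk_symmetric D))"
    unfolding two_connected_mk_symmetric_iff_cut[OF D.wf_digraph] using card2 by blast

  \<comment> \<open>The vertex set of a cycle is closed under in-neighbours, as the only arc into
    each of its vertices belongs to the cycle. By strong connectivity it is all of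
    \<open>verts D\<close>.\<close>
  have acyc: "acyclic_digraph (D \<restriction> S)" if S: "S \<subset> verts D" for S
    unfolding acyclic_digraph_def
  proof
    assume "\<exists>q. pre_digraph.cycle (D \<restriction> S) q"
    then obtain q where q: "pre_digraph.cycle (D \<restriction> S) q" by blast
    interpret S: wf_digraph "D \<restriction> S" by (rule D.wellformed_induce_subgraph)
    let ?T = "tail D ` set q"
    have qS: "set q \<subseteq> arcs (D \<restriction> S)" "q \<noteq> []" using q by (auto simp: S.cycle_def S.awalk_def)
    have TS: "?T \<subseteq> S" using qS by (auto simp: induce_subgraph_def)
    have heads_q: "head D ` set q = ?T"
      using cycle_image_head_eq_tail[OF S.wf_digraph q] by (simp add: induce_subgraph_def)
    have qD: "set q \<subseteq> arcs D" using qS by (auto simp: induce_subgraph_def)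
    obtain t where t: "t \<in> ?T" using qS by (cases q) auto
    have "x \<in> ?T" if "x \<rightarrow>\<^sup>*\<^bsub>D\<^esub> t" for x
      using that
    proof (induct rule: D.converse_reachable_induct)
      case (step x y)
      obtain e where e: "e \<in> arcs D" "tail D e = x" "head D e = y" using step(1) by auto
      obtain f where f: "f \<in> set q" "head D f = y" using step(3) unfolding heads_q[symmetric] by blast
      then have "e = f" using e qD inj by (metis inj_onD subsetD)
      then show ?case using e f by auto
    qed (rule t)
    then have "verts D \<subseteq> S" using reach t TS S by blast
    then show False using S by auto
  qed
  have "dichromatic_number D \<le> 2"
  proof -
    let ?v = "tail D e0"
    \<comment> \<open>Both parts are nonempty, hence both are proper subsets and \<open>acyc\<close>
      applies.\<close>
    let ?P = "{{?v}, verts D - {?v}}"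
    have v: "?v \<in> verts D" "head D e0 \<in> verts D - {?v}" using e0 D.no_loops[OF e0] by auto
    have "partition_on (verts D) ?P"
      using v by (auto simp: partition_on_def disjoint_def)
    moreover have "\<forall>S\<in>?P. acyclic_digraph (D \<restriction> S)" using v by (auto intro!: acyc)
    ultimately have "dichromatic_number D \<le> card ?P" by (intro dichromatic_number_le) auto
    also have "card ?P \<le> 2" by (simp add: card_insert_if)
    finally show ?thesis .
  qed
  moreover have "\<not> dichromatic_number D \<le> 1"
    using dichromatic_number_le_1_iff[OF assms(1)] D.tail_in_verts[OF e0] p(1)
    unfolding acyclic_digraph_def by blast
  ultimately have chi: "dichromatic_number D = 2" by simp

  \<comment> \<open>All paths to \<open>v\<close> share their last arc, the only one into
    \<open>v\<close>, so arc-disjoint ones coincide.\<close>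
  have local_le: "local_arc_connectivity D u v \<le> 1" if "u \<noteq> v" for u v
  proof (rule local_arc_connectivity_le[OF assms(1)])
    fix P assume P: "arc_disjoint_paths D u v P"
    have last: "q \<noteq> []" "last q \<in> arcs D" "head D (last q) = v" if "q \<in> P" for q
    proof -
      have q: "D.awalk u q v" using P that by (auto simp: arc_disjoint_paths_def D.apath_def)
      show ne: "q \<noteq> []" using q \<open>u \<noteq> v\<close> by (auto simp: D.awalk_Nil_iff)
      show "last q \<in> arcs D" using q ne by (auto simp: D.awalk_def)
      show "head D (last q) = v" using q ne by (auto simp: D.awalk_conv D.awalk_verts_conv)
    qed
    have "q = r" if "q \<in> P" "r \<in> P" for q r
    proof (rule ccontr)
      assume "q \<noteq> r"
      moreover have "last q = last r" using last that by (metis inj inj_onD)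
      moreover have "last q \<in> set q" "last r \<in> set r" using last(1) that by auto
      moreover have "disjnt (set q) (set r)" if "q \<noteq> r"
        using P \<open>q \<in> P\<close> \<open>r \<in> P\<close> that unfolding arc_disjoint_paths_def by (blast dest: pairwiseD)
      ultimately show False by (metis disjnt_iff)
    qed
    then show "card P \<le> 1" using P card_le_Suc0_iff_eq[of P] by (simp add: arc_disjoint_paths_def)
  qed
  \<comment> \<open>This pair serves twice: a path between its members gives the lower bound, and
    its existence permits the upper bound on the supremum.\<close>
  have uv: "tail D e0 \<in> verts D" "head D e0 \<in> verts D" "tail D e0 \<noteq> head D e0"
    using e0 D.no_loops[OF e0] by auto
  obtain q where "D.apath (tail D e0) q (head D e0)"
    using reach[OF uv(1,2)] D.reachable_apath by blast
  then have "arc_disjoint_paths D (tail D e0) (head D e0) {q}"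
    by (auto simp: arc_disjoint_paths_def pairwise_def)
  then have "1 \<le> local_arc_connectivity D (tail D e0) (head D e0)"
    using local_arc_connectivity_ge[OF assms(1), of _ _ "{q}"] by simp
  then have "1 \<le> max_local_arc_connectivity D"
    using max_local_arc_connectivity_ge[OF assms(1) uv] by simp
  moreover have "max_local_arc_connectivity D \<le> 1"
    by (rule max_local_arc_connectivity_le[OF uv local_le])
  ultimately show ?thesis using strong two chi by (simp add: extremal_def)
qed

theorem theorem4p3p2:
  fixes D :: "('a, 'b) pre_digraph"
  assumes "digraph D"
  shows "extremal 1 D \<longleftrightarrow> directed_cycle D"
  using extremal_1_imp_directed_cycle[OF assms] directed_cycle_imp_extremal_1[OF assms] by blast

end
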